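(* Let $n=p_{1}^{e_{1}}p_{2}^{e_{2}}\cdots p_{l}^{e_{l}}$ be the prime factorization of $n$ (distinct primes $p_r$, exponents $e_r\ge 1$). Then the number of linear permutation polynomials over the T-quaternion ring $\mathcal{S}_{\mathbb{Z}_{n}}$ is $$n^{2}\times\prod_{r=1}^{l}\left(p_{r}^{2(e_{r}-1)}\times|U(\mathcal{S}_{\mathbb{Z}_{p_{r}}})|\right),$$ where, for a prime $p$, $|U(\mathcal{S}_{\mathbb{Z}_{p}})|$ can be computed by the formulas: $|U(\mathcal{S}_{\mathbb{Z}_{p}})|=p^{2}-1$ if $p-3$ does not have a square root in $\mathbb{Z}_{p}$, and $|U(\mathcal{S}_{\mathbb{Z}_{p}})|=(p-1)^{2}$ if $p-3$ has square roots in $\mathbb{Z}_{p}$.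
   Context: For a commutative unital ring $\mathbf{R}$, let $\mathcal{H}_{\mathbf{R}}=\{w+xi+yj+zk : w,x,y,z\in\mathbf{R}\}$ be the ring of quaternions over $\mathbf{R}$, with componentwise addition and multiplication determined by $i^2=j^2=k^2=-1$, $ij=k$, $jk=i$, $ki=j$, $ji=-k$, $kj=-i$, $ik=-j$. The T-quaternion ring over $\mathbf{R}$ is the commutative unital subring $\mathcal{S}_{\mathbf{R}}=\{w+a(i+j+k) : w,a\in\mathbf{R}\}$ of $\mathcal{H}_{\mathbf{R}}$. $U(\cdot)$ denotes the unit group of a ring; $U(\mathcal{S}_{\mathbf{R}})=\{w+a(i+j+k) : w^2+3a^2\in U(\mathbf{R})\}$. $\mathbb{Z}_n$ is the ring of integers modulo $n$. A polynomial $f(X)\in\mathcal{S}_{\mathbb{Z}_n}[X]$ is a permutation polynomial over $\mathcal{S}_{\mathbb{Z}_n}$ if the induced map $f:\mathcal{S}_{\mathbb{Z}_n}\to\mathcal{S}_{\mathbb{Z}_n}$ is a bijection. A linear polynomial is $f(X)=AX+B$ with $A,B\in\mathcal{S}_{\mathbb{Z}_n}$, $A\ne 0$; polynomials are counted by their coefficients.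
   Formalization: The formula (p-1)^2 is stated for primes p such that p-3 has two distinct square roots in Z_p; this excludes only p=2 and p=3, where p-3 has a single root and the formula fails (the unit counts are 2 and 6). Also n≥2 (l≥1), since the count formula fails for n=1. *)

theory Defs
  imports "HOL-Number_Theory.Residues" "HOL-Algebra.Polynomials"
begin

datatype 'a quat = Quat (re: 'a) (im_i: 'a) (im_j: 'a) (im_k: 'a)

definition quaternion_ring :: "('a, 'm) ring_scheme \<Rightarrow> 'a quat ring" where
  "quaternion_ring R =
    \<lparr> carrier = {Quat w x y z | w x y z.
        w \<in> carrier R \<and> x \<in> carrier R \<and> y \<in> carrier R \<and> z \<in> carrier R},
      monoid.mult = (\<lambda>p q. Quat
        (re p \<otimes>\<^bsub>R\<^esub> re q \<ominus>\<^bsub>R\<^esub> im_i p \<otimes>\<^bsub>R\<^esub> im_i q \<ominus>\<^bsub>R\<^esub> im_j p \<otimes>\<^bsub>R\<^esub> im_j q \<ominus>\<^bsub>R\<^esub> im_k p \<otimes>\<^bsub>R\<^esub> im_k q)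
        (re p \<otimes>\<^bsub>R\<^esub> im_i q \<oplus>\<^bsub>R\<^esub> im_i p \<otimes>\<^bsub>R\<^esub> re q \<oplus>\<^bsub>R\<^esub> im_j p \<otimes>\<^bsub>R\<^esub> im_k q \<ominus>\<^bsub>R\<^esub> im_k p \<otimes>\<^bsub>R\<^esub> im_j q)
        (re p \<otimes>\<^bsub>R\<^esub> im_j q \<ominus>\<^bsub>R\<^esub> im_i p \<otimes>\<^bsub>R\<^esub> im_k q \<oplus>\<^bsub>R\<^esub> im_j p \<otimes>\<^bsub>R\<^esub> re q \<oplus>\<^bsub>R\<^esub> im_k p \<otimes>\<^bsub>R\<^esub> im_i q)
        (re p \<otimes>\<^bsub>R\<^esub> im_k q \<oplus>\<^bsub>R\<^esub> im_i p \<otimes>\<^bsub>R\<^esub> im_j q \<ominus>\<^bsub>R\<^esub> im_j p \<otimes>\<^bsub>R\<^esub> im_i q \<oplus>\<^bsub>R\<^esub> im_k p \<otimes>\<^bsub>R\<^esub> re q)),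
      one = Quat \<one>\<^bsub>R\<^esub> \<zero>\<^bsub>R\<^esub> \<zero>\<^bsub>R\<^esub> \<zero>\<^bsub>R\<^esub>,
      zero = Quat \<zero>\<^bsub>R\<^esub> \<zero>\<^bsub>R\<^esub> \<zero>\<^bsub>R\<^esub> \<zero>\<^bsub>R\<^esub>,
      add = (\<lambda>p q. Quat (re p \<oplus>\<^bsub>R\<^esub> re q) (im_i p \<oplus>\<^bsub>R\<^esub> im_i q)
        (im_j p \<oplus>\<^bsub>R\<^esub> im_j q) (im_k p \<oplus>\<^bsub>R\<^esub> im_k q)) \<rparr>"

text \<open>The element \<open>w + a(i + j + k)\<close> is \<open>Quat w a a a\<close>.\<close>

definition T_quaternions :: "('a, 'm) ring_scheme \<Rightarrow> 'a quat set" where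
  "T_quaternions R = {Quat w a a a | w a. w \<in> carrier R \<and> a \<in> carrier R}"

definition T_quaternion_ring :: "('a, 'm) ring_scheme \<Rightarrow> 'a quat ring" where
  "T_quaternion_ring R = (quaternion_ring R) \<lparr> carrier := T_quaternions R \<rparr>"

text \<open>Polynomials are coefficient lists, leading coefficient first and nonzero, so \<open>[A, B]\<close>
  is \<open>AX + B\<close>, and distinct polynomials may induce the same map.\<close>

definition permutation_polynomial :: "('a, 'm) ring_scheme \<Rightarrow> 'a list \<Rightarrow> bool" where
  "permutation_polynomial S f \<longleftrightarrow>
    f \<in> carrier (univ_poly S (carrier S)) \<and> bij_betw (ring.eval S f) (carrier S) (carrier S)"

definition linear_polynomial :: "('a, 'm) ring_scheme \<Rightarrow> 'a list \<Rightarrow> bool" where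
  "linear_polynomial S f \<longleftrightarrow>
    (\<exists>A \<in> carrier S. \<exists>B \<in> carrier S. A \<noteq> \<zero>\<^bsub>S\<^esub> \<and> f = [A, B])"

lemma (in cring) quaternion_mult_table:
  defines "H \<equiv> quaternion_ring R"
    and "qi \<equiv> Quat \<zero> \<one> \<zero> \<zero>" and "qj \<equiv> Quat \<zero> \<zero> \<one> \<zero>" and "qk \<equiv> Quat \<zero> \<zero> \<zero> \<one>"
    and "m \<equiv> Quat (\<ominus> \<one>) \<zero> \<zero> \<zero>"
  shows "qi \<otimes>\<^bsub>H\<^esub> qi = m" "qj \<otimes>\<^bsub>H\<^esub> qj = m" "qk \<otimes>\<^bsub>H\<^esub> qk = m"
    "qi \<otimes>\<^bsub>H\<^esub> qj = qk" "qj \<otimes>\<^bsub>H\<^esub> qk = qi" "qk \<otimes>\<^bsub>H\<^esub> qi = qj"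
    "qj \<otimes>\<^bsub>H\<^esub> qi = m \<otimes>\<^bsub>H\<^esub> qk" "qk \<otimes>\<^bsub>H\<^esub> qj = m \<otimes>\<^bsub>H\<^esub> qi" "qi \<otimes>\<^bsub>H\<^esub> qk = m \<otimes>\<^bsub>H\<^esub> qj"
  by (simp_all add: assms quaternion_ring_def minus_eq)

lemma (in cring) T_quaternion_mult:
  assumes "w \<in> carrier R" "a \<in> carrier R" "v \<in> carrier R" "b \<in> carrier R"
  shows "Quat w a a a \<otimes>\<^bsub>T_quaternion_ring R\<^esub> Quat v b b b =
    (let c = w \<otimes> b \<oplus> a \<otimes> v
     in Quat (w \<otimes> v \<ominus> (a \<otimes> b \<oplus> a \<otimes> b \<oplus> a \<otimes> b)) c c c)"
proof -
  have cancel: "x \<oplus> (y \<oplus> (z \<oplus> \<ominus> x)) = y \<oplus> z"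
    if "x \<in> carrier R" "y \<in> carrier R" "z \<in> carrier R" for x y z
  proof -
    have "x \<oplus> (y \<oplus> (z \<oplus> \<ominus> x)) = (y \<oplus> z) \<oplus> (x \<oplus> \<ominus> x)"
      using that by (simp only: a_ac a_closed a_inv_closed)
    then show ?thesis
      using that by (simp add: r_neg)
  qed
  show ?thesis
    using assms
    by (simp add: T_quaternion_ring_def quaternion_ring_def Let_def minus_eq minus_add
        a_ac m_ac cancel)
qed

lemma (in cring) T_quaternion_ring_is_cring: "cring (T_quaternion_ring R)"
proof -
  let ?S = "T_quaternion_ring R"
  have carrier: "carrier ?S = {Quat w a a a | w a. w \<in> carrier R \<and> a \<in> carrier R}"
    and add: "Quat w a b c \<oplus>\<^bsub>?S\<^esub> Quat w' a' b' c' =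
      Quat (w \<oplus> w') (a \<oplus> a') (b \<oplus> b') (c \<oplus> c')"
    and zero: "\<zero>\<^bsub>?S\<^esub> = Quat \<zero> \<zero> \<zero> \<zero>"
    and one: "\<one>\<^bsub>?S\<^esub> = Quat \<one> \<zero> \<zero> \<zero>" for w a b c w' a' b' c'
    by (simp_all add: T_quaternion_ring_def T_quaternions_def quaternion_ring_def)
  note S = carrier add zero one T_quaternion_mult Let_def
  show ?thesis
  proof (intro cringI abelian_groupI comm_monoidI)
    fix p assume "p \<in> carrier ?S"
    then obtain w a where p: "p = Quat w a a a" "w \<in> carrier R" "a \<in> carrier R"
      by (auto simp: S)
    then show "\<exists>q \<in> carrier ?S. q \<oplus>\<^bsub>?S\<^esub> p = \<zero>\<^bsub>?S\<^esub>"
      by (intro bexI[of _ "Quat (\<ominus> w) (\<ominus> a) (\<ominus> a) (\<ominus> a)"]) (auto simp: S l_neg)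
  qed (auto simp: S minus_eq l_distr r_distr minus_add l_minus r_minus a_ac m_ac)
qed

end

theory Submission
  imports Defs
begin

text \<open>
  A linear map \<open>A X + B\<close> over a commutative ring is bijective iff \<open>A\<close> is a unit. The norm
  \<open>w\<^sup>2 + 3 a\<^sup>2\<close> is multiplicative, so \<open>w + a(i + j + k)\<close> is a unit over \<open>\<int>\<^sub>n\<close> iff its norm is
  prime to \<open>n\<close>. Pairs \<open>(w, a)\<close> with this property are counted by the Chinese remainder theorem
  and, for prime powers, by the digits modulo \<open>p\<close>. For a prime modulus, the norm factors as
  \<open>(w - x a) (w + x a)\<close> if \<open>x\<^sup>2 = -3\<close>, and is anisotropic if \<open>-3\<close> is not a square.
\<close>

section \<open>Affine maps and linear polynomials over a commutative ring\<close>

lemma (in cring) bij_betw_affine_iff_unit: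
  assumes "A \<in> carrier R" "B \<in> carrier R"
  shows "bij_betw (\<lambda>x. A \<otimes> x \<oplus> B) (carrier R) (carrier R) \<longleftrightarrow> A \<in> Units R"
proof
  assume "bij_betw (\<lambda>x. A \<otimes> x \<oplus> B) (carrier R) (carrier R)"
  \<comment> \<open>The value \<open>\<one> \<oplus> B\<close> is chosen so that cancelling
    \<open>B\<close> turns its preimage into an inverse of \<open>A\<close>.\<close>
  then have "\<one> \<oplus> B \<in> (\<lambda>x. A \<otimes> x \<oplus> B) ` carrier R"
    using assms by (simp add: bij_betw_def)
  then obtain x where x: "x \<in> carrier R" "A \<otimes> x \<oplus> B = \<one> \<oplus> B"
    by auto
  then have "A \<otimes> x = \<one>"
    using assms by simp
  then show "A \<in> Units R"
    using x assms by (auto simp: Units_def m_comm intro!: bexI[of _ x])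
next
  assume A: "A \<in> Units R"
  have inverse: "A \<otimes> (inv A \<otimes> y) = y" "inv A \<otimes> (A \<otimes> y) = y" if "y \<in> carrier R" for y
    using A assms that by (simp_all flip: m_assoc)
  have cancel: "y \<oplus> B \<ominus> B = y" "y \<ominus> B \<oplus> B = y" if "y \<in> carrier R" for y
    using assms that by (simp_all add: minus_eq a_assoc r_neg l_neg)
  show "bij_betw (\<lambda>x. A \<otimes> x \<oplus> B) (carrier R) (carrier R)"
    using A assms by (intro bij_betw_byWitness[where f' = "\<lambda>y. inv A \<otimes> (y \<ominus> B)"])
      (auto simp: inverse cancel)
qed

text \<open>Since polynomials are coefficient lists, a pair \<open>(A, B)\<close> is recovered from
  \<open>[A, B]\<close>, so the set can be counted as a product. With
  \<open>\<one> \<noteq> \<zero>\<close> a unit is nonzero, so every unit is admissible as leading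
  coefficient.\<close>

lemma (in cring) linear_permutation_polynomials:
  assumes "\<one> \<noteq> \<zero>"
  shows "{f. linear_polynomial R f \<and> permutation_polynomial R f} =
    (\<lambda>(A, B). [A, B]) ` (Units R \<times> carrier R)"
proof -
  have "permutation_polynomial R [A, B] \<longleftrightarrow> A \<in> Units R"
    if "A \<in> carrier R" "B \<in> carrier R" "A \<noteq> \<zero>" for A B
  proof -
    have "bij_betw (eval [A, B]) (carrier R) (carrier R) \<longleftrightarrow>
        bij_betw (\<lambda>x. A \<otimes> x \<oplus> B) (carrier R) (carrier R)"
      using that by (intro bij_betw_cong) simp
    moreover have "[A, B] \<in> carrier (univ_poly R (carrier R))"
      using that by (simp add: univ_poly_def polynomial_def)
    ultimately show ?thesis
      using that by (simp add: permutation_polynomial_def bij_betw_affine_iff_unit)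
  qed
  moreover have "\<zero> \<notin> Units R"
    using assms by (auto simp: Units_def)
  ultimately show ?thesis
    by (auto simp: linear_polynomial_def image_iff)
qed

section \<open>Counting pairs of residues whose norm is invertible\<close>

text \<open>A model of the unit group by least nonnegative representatives, so that the counting
  takes place among integers and congruences.\<close>

definition norm_units :: "int \<Rightarrow> (int \<times> int) set" where
  "norm_units m = {(w, a). w \<in> {0..<m} \<and> a \<in> {0..<m} \<and> coprime (w\<^sup>2 + 3 * a\<^sup>2) m}"

lemma norm_cong:
  fixes w a v b m :: int
  assumes "[w = v] (mod m)" "[a = b] (mod m)"
  shows "[w\<^sup>2 + 3 * a\<^sup>2 = v\<^sup>2 + 3 * b\<^sup>2] (mod m)"
  using assms by (intro cong_add cong_mult cong_pow cong_refl)

lemma coprime_norm_mod_iff: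
  fixes w a m :: int
  shows "coprime ((w mod m)\<^sup>2 + 3 * (a mod m)\<^sup>2) m \<longleftrightarrow> coprime (w\<^sup>2 + 3 * a\<^sup>2) m"
proof -
  have "[(w mod m)\<^sup>2 + 3 * (a mod m)\<^sup>2 = w\<^sup>2 + 3 * a\<^sup>2] (mod m)"
    by (intro norm_cong) (simp_all add: cong_def)
  then show ?thesis
    by (metis cong_imp_coprime cong_sym)
qed

text \<open>The Chinese remainder theorem is applied to each coordinate separately; the norm is
  prime to \<open>m * k\<close> iff it is prime to both factors, and each of these conditions
  depends only on the residues modulo that factor.\<close>

lemma card_norm_units_mult:
  assumes "m > 0" "k > 0" "coprime m k"
  shows "card (norm_units (m * k)) = card (norm_units m) * card (norm_units k)"
proof -
  let ?f = "\<lambda>(w, a). ((w mod m, a mod m), (w mod k, a mod k))"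
  have eqI: "x = y" if "x mod m = y mod m" "x mod k = y mod k" "x \<in> {0..<m * k}" "y \<in> {0..<m * k}" for x y
  proof -
    have "[x = y] (mod m * k)"
      using that assms by (intro coprime_cong_mult) (simp_all add: cong_def)
    then show ?thesis
      using that by (simp add: cong_def)
  qed
  have crt: "\<exists>x \<in> {0..<m * k}. x mod m = y \<and> x mod k = z"
    if "y \<in> {0..<m}" "z \<in> {0..<k}" for y z
  proof -
    obtain x where x: "[x = y] (mod m)" "[x = z] (mod k)"
      using binary_chinese_remainder_int[OF assms(3)] by blast
    have "(x mod (m * k)) mod m = y" "(x mod (m * k)) mod k = z"
      using x that by (simp_all add: cong_def mod_mod_cancel)
    then show ?thesis
      using assms by (intro bexI[of _ "x mod (m * k)"]) auto
  qed
  have "bij_betw ?f (norm_units (m * k)) (norm_units m \<times> norm_units k)"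
    unfolding bij_betw_def
  proof
    show "inj_on ?f (norm_units (m * k))"
      by (intro inj_onI) (auto simp: norm_units_def intro!: eqI)
    show "?f ` norm_units (m * k) = norm_units m \<times> norm_units k"
    proof (intro equalityI subsetI)
      fix t assume "t \<in> ?f ` norm_units (m * k)"
      then show "t \<in> norm_units m \<times> norm_units k"
        using assms by (auto simp: norm_units_def coprime_norm_mod_iff)
    next
      fix t assume t: "t \<in> norm_units m \<times> norm_units k"
      obtain w a v b where t_eq: "t = ((w, a), (v, b))"
        by (metis surj_pair)
      obtain x where x: "x \<in> {0..<m * k}" "x mod m = w" "x mod k = v"
        using t crt[of w v] by (auto simp: t_eq norm_units_def)
      obtain y where y: "y \<in> {0..<m * k}" "y mod m = a" "y mod k = b"
        using t crt[of a b] by (auto simp: t_eq norm_units_def)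
      have "coprime (x\<^sup>2 + 3 * y\<^sup>2) m" "coprime (x\<^sup>2 + 3 * y\<^sup>2) k"
        using t x y coprime_norm_mod_iff[of x m y] coprime_norm_mod_iff[of x k y]
        by (simp_all add: t_eq norm_units_def)
      then have "(x, y) \<in> norm_units (m * k)"
        using x y by (simp add: norm_units_def)
      moreover have "t = ?f (x, y)"
        using x y by (simp add: t_eq)
      ultimately show "t \<in> ?f ` norm_units (m * k)"
        by (rule rev_image_eqI)
    qed
  qed
  from bij_betw_same_card[OF this] show ?thesis
    by (simp add: card_cartesian_product)
qed

text \<open>Being prime to \<open>m ^ Suc e\<close> is being prime to \<open>m\<close>, a condition
  on the lowest base-\<open>m\<close> digits of \<open>w\<close> and \<open>a\<close> only. The
  remaining parts of the two coordinates range freely over \<open>m ^ e\<close> values each.\<close>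

lemma card_norm_units_power:
  assumes "m > 0"
  shows "card (norm_units (m ^ Suc e)) = nat m ^ (2 * e) * card (norm_units m)"
proof -
  let ?D = "{0..<m ^ e} \<times> {0..<m ^ e}"
  let ?g = "\<lambda>((w, a), (v, b)). (w + m * v, a + m * b)"
  have digit: "x mod m + m * (x div m) = x" "x mod m \<in> {0..<m}" for x
    using assms by auto
  have upper: "x div m \<in> {0..<m ^ e} \<longleftrightarrow> x \<in> {0..<m * m ^ e}" for x
  proof -
    have "x div m < m ^ e \<longleftrightarrow> x < m * m ^ e"
    proof
      assume "x div m < m ^ e"
      \<comment> \<open>The strict bound between integers is sharpened by 1 before multiplying by
        \<open>m\<close>; the gain of \<open>m\<close> absorbs the remainder
        \<open>x mod m\<close>.\<close>
      then have "m * (x div m + 1) \<le> m * m ^ e"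
        using assms by (intro mult_left_mono) auto
      then show "x < m * m ^ e"
        using digit(1)[of x] pos_mod_bound[OF assms, of x] unfolding distrib_left by linarith
    next
      assume "x < m * m ^ e"
      moreover have "m * m ^ e \<le> m * (x div m)" if "m ^ e \<le> x div m"
        using that assms by (intro mult_left_mono) auto
      ultimately show "x div m < m ^ e"
        using digit(1)[of x] pos_mod_sign[OF assms, of x] by linarith
    qed
    then show ?thesis
      using assms by (simp add: pos_imp_zdiv_nonneg_iff)
  qed
  have mem_iff: "(x, y) \<in> norm_units (m ^ Suc e) \<longleftrightarrow>
      (x mod m, y mod m) \<in> norm_units m \<and> x div m \<in> {0..<m ^ e} \<and> y div m \<in> {0..<m ^ e}" for x y
    unfolding upper using digit(2) by (auto simp: norm_units_def coprime_norm_mod_iff)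
  have low: "(w + m * v) mod m = w" "(w + m * v) div m = v" if "w \<in> {0..<m}" for w v
    using that by auto
  have "bij_betw ?g (norm_units m \<times> ?D) (norm_units (m ^ Suc e))"
  proof (rule bij_betw_byWitness[where
        f' = "\<lambda>(x, y). ((x mod m, y mod m), (x div m, y div m))"])
    show "\<forall>t \<in> norm_units m \<times> ?D. (\<lambda>(x, y). ((x mod m, y mod m), (x div m, y div m))) (?g t) = t"
      by (auto simp: norm_units_def low)
    show "?g ` (norm_units m \<times> ?D) \<subseteq> norm_units (m ^ Suc e)"
    proof clarify
      fix w a v b assume "(w, a) \<in> norm_units m" "v \<in> {0..<m ^ e}" "b \<in> {0..<m ^ e}"
      then show "(w + m * v, a + m * b) \<in> norm_units (m ^ Suc e)"
        unfolding mem_iff by (auto simp: norm_units_def low)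
    qed
  qed (use mem_iff in auto)
  from bij_betw_same_card[OF this] show ?thesis
    using assms by (simp add: card_cartesian_product nat_power_eq power_mult power2_eq_square power_mult_distrib mult.commute)
qed

lemma card_norm_units_prod:
  fixes p e :: "'a \<Rightarrow> nat"
  assumes "finite I" "\<And>r. r \<in> I \<Longrightarrow> Factorial_Ring.prime (p r)" "inj_on p I"
    "\<And>r. r \<in> I \<Longrightarrow> e r \<ge> 1"
  shows "card (norm_units (int (\<Prod>r \<in> I. p r ^ e r))) =
    (\<Prod>r \<in> I. p r ^ (2 * (e r - 1)) * card (norm_units (int (p r))))"
  using assms
proof (induction I)
  case empty
  \<comment> \<open>The empty product is the modulus 1: its only residue is 0, and 0 is prime to
    1.\<close>
  have "norm_units 1 = {(0, 0)}"
    by (auto simp: norm_units_def)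
  then show ?case by simp
next
  case (insert r I)
  let ?m = "p r ^ e r" and ?k = "\<Prod>r \<in> I. p r ^ e r"
  have pos: "p s > 0" if "s \<in> insert r I" for s
    using insert.prems(1)[OF that] by (rule prime_gt_0_nat)
  have "coprime ?m ?k"
  proof (intro prod_coprime_right)
    fix s assume "s \<in> I"
    then have "p r \<noteq> p s"
      using insert.prems(2) insert.hyps(2) by auto
    then show "coprime ?m (p s ^ e s)"
      using insert.prems(1) \<open>s \<in> I\<close> by (simp add: primes_coprime)
  qed
  moreover have "?m > 0" "?k > 0"
    using pos by (auto intro: prod_pos)
  ultimately have "card (norm_units (int ?m * int ?k)) = card (norm_units (int ?m)) * card (norm_units (int ?k))"
    by (intro card_norm_units_mult) (simp_all only: of_nat_0_less_iff coprime_int_iff)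
  \<comment> \<open>From \<open>e r \<ge> 1\<close>, the exponent \<open>e r\<close> is the
    successor of \<open>e r - 1\<close>, as the prime power count requires.\<close>
  moreover have "card (norm_units (int ?m)) = p r ^ (2 * (e r - 1)) * card (norm_units (int (p r)))"
    using card_norm_units_power[of "int (p r)" "e r - 1"] pos[of r] insert.prems(3)[of r]
    by (simp del: power_Suc)
  moreover have "card (norm_units (int ?k)) =
      (\<Prod>r \<in> I. p r ^ (2 * (e r - 1)) * card (norm_units (int (p r))))"
    using insert.prems by (intro insert.IH) auto
  ultimately show ?case
    using insert.hyps by simp
qed

section \<open>Units and linear permutation polynomials over the residue rings\<close>

context residues
begin

lemma T_quaternion_mult_residues:
  "Quat w a a a \<otimes>\<^bsub>T_quaternion_ring R\<^esub> Quat v b b b =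
    (let c = (w * b + a * v) mod m in Quat ((w * v - 3 * (a * b)) mod m) c c c)"
  if "w \<in> carrier R" "a \<in> carrier R" "v \<in> carrier R" "b \<in> carrier R"
proof -
  have "w \<otimes> v \<ominus> (a \<otimes> b \<oplus> a \<otimes> b \<oplus> a \<otimes> b) = (w * v - 3 * (a * b)) mod m"
    by (simp add: a_minus_def res_neg_eq res_mult_eq res_add_eq mod_simps algebra_simps)
  moreover have "w \<otimes> b \<oplus> a \<otimes> v = (w * b + a * v) mod m"
    by (simp add: res_mult_eq res_add_eq mod_simps)
  ultimately show ?thesis
    using that by (simp add: T_quaternion_mult)
qed

text \<open>Taking norms in a product equal to 1 makes the norm of each factor invertible;
  conversely, the conjugate divided by the norm is an inverse.\<close>

lemma Units_T_quaternion_ring: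
  "Units (T_quaternion_ring R) = (\<lambda>(w, a). Quat w a a a) ` norm_units m"
proof -
  let ?S = "T_quaternion_ring R"
  interpret S: cring ?S
    by (rule T_quaternion_ring_is_cring)
  have carrier: "carrier ?S = {Quat w a a a | w a. w \<in> {0..<m} \<and> a \<in> {0..<m}}"
    by (auto simp: T_quaternion_ring_def T_quaternions_def res_carrier_eq)
  have one: "\<one>\<^bsub>?S\<^esub> = Quat 1 0 0 0"
    by (simp add: T_quaternion_ring_def quaternion_ring_def res_one_eq res_zero_eq)
  have R: "carrier R = {0..<m}"
    by (auto simp: res_carrier_eq)
  have product_eq_one_iff: "Quat w a a a \<otimes>\<^bsub>?S\<^esub> Quat v b b b = \<one>\<^bsub>?S\<^esub> \<longleftrightarrow>
      [w * v - 3 * (a * b) = 1] (mod m) \<and> [w * b + a * v = 0] (mod m)"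
    if "w \<in> {0..<m}" "a \<in> {0..<m}" "v \<in> {0..<m}" "b \<in> {0..<m}" for w a v b
    using that m_gt_one by (auto simp: T_quaternion_mult_residues R one Let_def cong_def)
  have unit_iff: "Quat w a a a \<in> Units ?S \<longleftrightarrow> coprime (w\<^sup>2 + 3 * a\<^sup>2) m"
    if wa: "w \<in> {0..<m}" "a \<in> {0..<m}" for w a
  proof
    assume "Quat w a a a \<in> Units ?S"
    then obtain q where "q \<in> carrier ?S" "Quat w a a a \<otimes>\<^bsub>?S\<^esub> q = \<one>\<^bsub>?S\<^esub>"
      by (auto simp: Units_def)
    then obtain v b where "[w * v - 3 * (a * b) = 1] (mod m)" "[w * b + a * v = 0] (mod m)"
      using wa product_eq_one_iff by (auto simp: carrier)
    then have "[(w * v - 3 * (a * b))\<^sup>2 + 3 * (w * b + a * v)\<^sup>2 = 1\<^sup>2 + 3 * 0\<^sup>2] (mod m)"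
      by (rule norm_cong)
    \<comment> \<open>Brahmagupta's identity for the form \<open>w\<^sup>2 + 3 * a\<^sup>2\<close>:
      the norm of the product is the product of the norms.\<close>
    moreover have "(w * v - 3 * (a * b))\<^sup>2 + 3 * (w * b + a * v)\<^sup>2 =
        (w\<^sup>2 + 3 * a\<^sup>2) * (v\<^sup>2 + 3 * b\<^sup>2)"
      by (simp add: power2_eq_square algebra_simps)
    ultimately show "coprime (w\<^sup>2 + 3 * a\<^sup>2) m"
      by (auto simp: coprime_iff_invertible_int)
  next
    assume "coprime (w\<^sup>2 + 3 * a\<^sup>2) m"
    then obtain u where u: "[(w\<^sup>2 + 3 * a\<^sup>2) * u = 1] (mod m)"
      by (auto simp: coprime_iff_invertible_int)
    \<comment> \<open>The candidate inverse is the conjugate \<open>w - a(i + j + k)\<close> scaled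
      by \<open>u\<close>, the inverse of the norm.\<close>
    define v b where "v = (w * u) mod m" and "b = (- (a * u)) mod m"
    have vb: "[v = w * u] (mod m)" "[b = - (a * u)] (mod m)" "v \<in> {0..<m}" "b \<in> {0..<m}"
      using m_gt_one by (auto simp: v_def b_def cong_def)
    have "[w * v - 3 * (a * b) = w * (w * u) - 3 * (a * - (a * u))] (mod m)"
      using vb by (intro cong_diff cong_mult cong_refl)
    also have "w * (w * u) - 3 * (a * - (a * u)) = (w\<^sup>2 + 3 * a\<^sup>2) * u"
      by (simp add: power2_eq_square algebra_simps)
    also note u
    finally have re: "[w * v - 3 * (a * b) = 1] (mod m)" .
    have "[w * b + a * v = w * - (a * u) + a * (w * u)] (mod m)"
      using vb by (intro cong_add cong_mult cong_refl)
    then have "[w * b + a * v = 0] (mod m)"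
      by (simp add: algebra_simps)
    with re have "Quat w a a a \<otimes>\<^bsub>?S\<^esub> Quat v b b b = \<one>\<^bsub>?S\<^esub>"
      using wa vb by (simp add: product_eq_one_iff)
    moreover have "Quat w a a a \<in> carrier ?S" "Quat v b b b \<in> carrier ?S"
      using wa vb by (auto simp: carrier)
    ultimately show "Quat w a a a \<in> Units ?S"
      by (auto simp: Units_def S.m_comm)
  qed
  show ?thesis
  proof (intro equalityI subsetI)
    fix u assume u: "u \<in> Units ?S"
    then obtain w a where "u = Quat w a a a" "w \<in> {0..<m}" "a \<in> {0..<m}"
      using S.Units_closed[OF u] by (auto simp: carrier)
    moreover from this have "(w, a) \<in> norm_units m"
      using u unit_iff by (simp add: norm_units_def)
    ultimately show "u \<in> (\<lambda>(w, a). Quat w a a a) ` norm_units m"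
      by force
  qed (use unit_iff in \<open>auto simp: norm_units_def\<close>)
qed

lemma card_Units_T_quaternion_ring: "card (Units (T_quaternion_ring R)) = card (norm_units m)"
  unfolding Units_T_quaternion_ring by (intro card_image) (auto simp: inj_on_def)

lemma card_T_quaternions: "card (carrier (T_quaternion_ring R)) = nat m ^ 2"
proof -
  have "carrier (T_quaternion_ring R) = (\<lambda>(w, a). Quat w a a a) ` ({0..<m} \<times> {0..<m})"
    by (auto simp: T_quaternion_ring_def T_quaternions_def res_carrier_eq image_iff)
  moreover have "inj_on (\<lambda>(w, a). Quat w a a a) ({0..<m} \<times> {0..<m})"
    by (auto simp: inj_on_def)
  ultimately show ?thesis
    by (simp add: card_image card_cartesian_product power2_eq_square)
qed

text \<open>The constant term is any of the \<open>nat m ^ 2\<close> ring elements, and the leading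
  coefficient is any unit.\<close>

lemma card_linear_permutation_polynomials:
  "card {f. linear_polynomial (T_quaternion_ring R) f \<and> permutation_polynomial (T_quaternion_ring R) f}
    = nat m ^ 2 * card (norm_units m)"
proof -
  interpret S: cring "T_quaternion_ring R"
    by (rule T_quaternion_ring_is_cring)
  have "\<one>\<^bsub>T_quaternion_ring R\<^esub> \<noteq> \<zero>\<^bsub>T_quaternion_ring R\<^esub>"
    by (simp add: T_quaternion_ring_def quaternion_ring_def res_one_eq res_zero_eq)
  then show ?thesis
    by (simp add: S.linear_permutation_polynomials card_image inj_on_def card_cartesian_product
        card_Units_T_quaternion_ring card_T_quaternions)
qed

end

section \<open>Zeros of the norm form modulo a prime\<close>

context
  fixes q :: int
  assumes q: "Factorial_Ring.prime q"
begin

lemma coprime_iff_not_dvd: "coprime x q \<longleftrightarrow> \<not> q dvd x"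
  using prime_imp_coprime[OF q, of x] coprime_absorb_left[of q x] not_prime_unit q
  by (auto simp: coprime_commute)

lemma norm_units_prime:
  "norm_units q = {0..<q} \<times> {0..<q} - {(w, a). w \<in> {0..<q} \<and> a \<in> {0..<q} \<and> q dvd w\<^sup>2 + 3 * a\<^sup>2}"
  by (auto simp: norm_units_def coprime_iff_not_dvd)

lemma card_norm_units_prime:
  "card (norm_units q) = nat q ^ 2 - card {(w, a). w \<in> {0..<q} \<and> a \<in> {0..<q} \<and> q dvd w\<^sup>2 + 3 * a\<^sup>2}"
  unfolding norm_units_prime
  by (subst card_Diff_subset)
    (auto simp: card_cartesian_product power2_eq_square intro: finite_subset[of _ "{0..<q} \<times> {0..<q}"])

text \<open>A zero of the norm with \<open>a \<noteq> 0\<close> would make \<open>w / a\<close> a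
  square root of -3 modulo \<open>q\<close>, so the origin is the only zero.\<close>

lemma card_norm_units_nonsquare:
  assumes "\<And>x. \<not> [x\<^sup>2 = -3] (mod q)"
  shows "card (norm_units q) = nat q ^ 2 - 1"
proof -
  have zero: "w = 0 \<and> a = 0" if wa: "w \<in> {0..<q}" "a \<in> {0..<q}" and dvd: "q dvd w\<^sup>2 + 3 * a\<^sup>2" for w a
  proof -
    have "a = 0"
    proof (rule ccontr)
      assume "a \<noteq> 0"
      then have "\<not> q dvd a"
        using wa zdvd_imp_le[of q a] by auto
      then have "coprime a q"
        by (simp add: coprime_iff_not_dvd)
      then obtain u where u: "[a * u = 1] (mod q)"
        by (auto simp: coprime_iff_invertible_int)
      \<comment> \<open>Multiplying by the square of the inverse \<open>u\<close> of
        \<open>a\<close> exhibits \<open>w * u\<close> as the forbidden root.\<close>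
      have "q dvd (w\<^sup>2 + 3 * a\<^sup>2) * u\<^sup>2"
        using dvd by simp
      then have "[(w * u)\<^sup>2 = -3 * (a * u)\<^sup>2] (mod q)"
        by (simp add: cong_iff_dvd_diff algebra_simps)
      also have "[-3 * (a * u)\<^sup>2 = -3 * 1\<^sup>2] (mod q)"
        using u by (intro cong_mult cong_pow cong_refl)
      finally show False
        using assms by simp
    qed
    with dvd have "q dvd w"
      using q by (simp add: prime_dvd_power_iff)
    with wa \<open>a = 0\<close> show ?thesis
      using zdvd_imp_le[of q w] by (cases "w > 0") auto
  qed
  have "{(w, a). w \<in> {0..<q} \<and> a \<in> {0..<q} \<and> q dvd w\<^sup>2 + 3 * a\<^sup>2} = {(0, 0)}"
    using zero prime_gt_0_int[OF q] by (auto 4 3)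
  then show ?thesis
    by (simp add: card_norm_units_prime)
qed

text \<open>The zeros form two lines of \<open>q\<close> points each that meet only at the origin,
  which leaves \<open>q\<^sup>2 - (2 * q - 1)\<close> pairs. Two incongruent roots exclude
  \<open>q = 2\<close> and \<open>q = 3\<close>: there -3 has a single root and the norm is the
  square of one linear form.\<close>

lemma card_norm_units_square:
  assumes x: "[x\<^sup>2 = -3] (mod q)" and y: "[y\<^sup>2 = -3] (mod q)" and "\<not> [x = y] (mod q)"
  shows "card (norm_units q) = (nat q - 1) ^ 2"
proof -
  let ?Z = "{(w, a). w \<in> {0..<q} \<and> a \<in> {0..<q} \<and> q dvd w\<^sup>2 + 3 * a\<^sup>2}"
  have "[x\<^sup>2 = y\<^sup>2] (mod q)"
    using x y by (metis cong_sym cong_trans)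
  then have "q dvd x\<^sup>2 - y\<^sup>2"
    by (simp add: cong_iff_dvd_diff)
  also have "x\<^sup>2 - y\<^sup>2 = (x - y) * (x + y)"
    by (simp add: power2_eq_square algebra_simps)
  finally have "q dvd (x - y) * (x + y)" .
  moreover have xy: "\<not> q dvd x - y"
    using assms by (simp add: cong_iff_dvd_diff)
  \<comment> \<open>The two roots are negatives of each other modulo \<open>q\<close>.\<close>
  ultimately have sum: "q dvd x + y"
    using q by (simp add: prime_dvd_mult_iff)
  have split: "q dvd w\<^sup>2 + 3 * a\<^sup>2 \<longleftrightarrow> q dvd w - x * a \<or> q dvd w - y * a" for w a
  proof -
    have "q dvd x\<^sup>2 + 3"
      using x by (simp add: cong_iff_dvd_diff)
    \<comment> \<open>An exact integer identity: the correction to the product of linear forms is a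
      combination of \<open>x + y\<close> and \<open>x\<^sup>2 + 3\<close>, both divisible by
      \<open>q\<close>.\<close>
    moreover have "w\<^sup>2 + 3 * a\<^sup>2 =
        (w - x * a) * (w - y * a) + ((x + y) * (a * w - x * a\<^sup>2) + (x\<^sup>2 + 3) * a\<^sup>2)"
      by (simp add: power2_eq_square algebra_simps)
    ultimately have "q dvd w\<^sup>2 + 3 * a\<^sup>2 \<longleftrightarrow> q dvd (w - x * a) * (w - y * a)"
      using sum by (metis dvd_add_left_iff dvd_add dvd_mult2)
    then show ?thesis
      using q by (simp add: prime_dvd_mult_iff)
  qed
  \<comment> \<open>\<open>L z\<close> is the line \<open>w = z * a\<close> modulo \<open>q\<close>,
    parametrized by \<open>a\<close>; hence it has \<open>q\<close> points.\<close>
  define L where "L z = (\<lambda>a. (z * a mod q, a)) ` {0..<q}" for z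
  have q0: "q > 0"
    using q by (rule prime_gt_0_int)
  have L: "(w, a) \<in> L z \<longleftrightarrow> w \<in> {0..<q} \<and> a \<in> {0..<q} \<and> q dvd w - z * a" for w a z
    using q0 by (auto simp: L_def image_iff mod_eq_dvd_iff[symmetric])
  have "?Z = L x \<union> L y"
    by (auto simp: L split)
  moreover have "L x \<inter> L y = {(0, 0)}"
  proof -
    have only_zero: "(w, a) = (0, 0)" if "(w, a) \<in> L x" "(w, a) \<in> L y" for w a
    proof -
      have "q dvd w - y * a" "q dvd w - x * a"
        using that by (simp_all add: L)
      then have "q dvd (w - y * a) - (w - x * a)"
        by (rule dvd_diff)
      then have "q dvd (x - y) * a"
        by (simp add: algebra_simps)
      then have "q dvd a"
        using q xy by (simp add: prime_dvd_mult_iff)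
      then have "a = 0"
        using that zdvd_imp_le[of q a] by (cases "a > 0") (auto simp: L)
      then show ?thesis
        using that by (auto simp: L_def)
    qed
    show ?thesis
    proof (intro equalityI subsetI)
      fix t assume "t \<in> L x \<inter> L y"
      then show "t \<in> {(0, 0)}"
        using only_zero[of "fst t" "snd t"] by simp
    qed (use q0 in \<open>auto simp: L\<close>)
  qed
  moreover have "card (L z) = nat q" "finite (L z)" for z
    by (simp_all add: L_def card_image inj_on_def)
  \<comment> \<open>Inclusion-exclusion; the 1 is the origin, shared by both lines.\<close>
  ultimately have "card ?Z + 1 = nat q + nat q"
    using card_Un_Int[of "L x" "L y"] by simp
  then have "card ?Z = 2 * nat q - 1"
    by simp
  \<comment> \<open>Writing \<open>q\<close> as a successor resolves the truncated subtractions: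
    \<open>(k + 1)\<^sup>2 - (2 * k + 1) = k\<^sup>2\<close>.\<close>
  moreover obtain k where "nat q = Suc k"
    using q0 by (metis gr0_implies_Suc zero_less_nat_eq)
  ultimately show ?thesis
    by (simp add: card_norm_units_prime power2_eq_square)
qed

end

section \<open>Assembling the count modulo \<open>n\<close> and the two formulas for primes\<close>

theorem theorem16:
  fixes n l :: nat and p e :: "nat \<Rightarrow> nat"
  assumes "l \<ge> 1"
    and "\<And>r. r \<in> {1..l} \<Longrightarrow> Factorial_Ring.prime (p r)"
    and "inj_on p {1..l}"
    and "\<And>r. r \<in> {1..l} \<Longrightarrow> e r \<ge> 1"
    and "n = (\<Prod>r = 1..l. p r ^ e r)"
  shows
    "card {f. linear_polynomial (T_quaternion_ring (residue_ring (int n))) f \<and>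
              permutation_polynomial (T_quaternion_ring (residue_ring (int n))) f}
      = n ^ 2 * (\<Prod>r = 1..l. p r ^ (2 * (e r - 1)) *
          card (Units (T_quaternion_ring (residue_ring (int (p r))))))
    \<and> (\<forall>q::nat. Factorial_Ring.prime q \<longrightarrow>
        ((\<nexists>x. x \<in> carrier (residue_ring (int q)) \<and>
              x \<otimes>\<^bsub>residue_ring (int q)\<^esub> x = (int q - 3) mod int q) \<longrightarrow>
          card (Units (T_quaternion_ring (residue_ring (int q)))) = q ^ 2 - 1) \<and>
        ((\<exists>x y. x \<in> carrier (residue_ring (int q)) \<and> y \<in> carrier (residue_ring (int q)) \<and> x \<noteq> y \<and>
              x \<otimes>\<^bsub>residue_ring (int q)\<^esub> x = (int q - 3) mod int q \<and>
              y \<otimes>\<^bsub>residue_ring (int q)\<^esub> y = (int q - 3) mod int q) \<longrightarrow>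
          card (Units (T_quaternion_ring (residue_ring (int q)))) = (q - 1) ^ 2))"
proof (intro conjI allI impI)
  have residues_prime: "residues (int q)" if "Factorial_Ring.prime q" for q :: nat
    using prime_gt_1_nat[OF that] by (simp add: residues_def)
  \<comment> \<open>The element \<open>(int q - 3) mod int q\<close> represents -3, also for
    \<open>q = 2\<close>, where \<open>int q - 3\<close> is negative.\<close>
  have root_iff: "x \<otimes>\<^bsub>residue_ring (int q)\<^esub> x = (int q - 3) mod int q \<longleftrightarrow> [x\<^sup>2 = -3] (mod int q)"
    for q :: nat and x
    by (simp add: residue_ring_def cong_def power2_eq_square)
  have carrier: "carrier (residue_ring (int q)) = {0..<int q}" for q :: nat
    by (auto simp: residue_ring_def)
  \<comment> \<open>Since \<open>l \<ge> 1\<close>, some prime divides \<open>n\<close>; this gives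
    \<open>n > 1\<close>, so the residue ring is nontrivial.\<close>
  have "p 1 dvd n"
  proof -
    have "p 1 dvd p 1 ^ e 1"
      using assms(1) assms(4)[of 1] by (intro dvd_power) simp
    also have "\<dots> dvd n"
      unfolding assms(5) using assms(1) by (intro dvd_prodI) auto
    finally show ?thesis .
  qed
  moreover have "n > 0"
    using assms(2,5) by (auto intro!: prod_pos simp: prime_gt_0_nat)
  ultimately have "n > 1"
    using prime_gt_1_nat[OF assms(2)[of 1]] assms(1) dvd_imp_le[of "p 1" n] by simp
  then interpret residues "int n" "residue_ring (int n)"
    by (simp_all add: residues_def)
  have "(\<Prod>r = 1..l. p r ^ (2 * (e r - 1)) * card (Units (T_quaternion_ring (residue_ring (int (p r)))))) =
      (\<Prod>r = 1..l. p r ^ (2 * (e r - 1)) * card (norm_units (int (p r))))"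
    using assms(2) by (intro prod.cong refl)
      (simp add: residues.card_Units_T_quaternion_ring[OF residues_prime])
  also have "\<dots> = card (norm_units (int n))"
    unfolding assms(5) using assms(2-4) by (intro card_norm_units_prod[symmetric]) auto
  finally show "card {f. linear_polynomial (T_quaternion_ring (residue_ring (int n))) f \<and>
              permutation_polynomial (T_quaternion_ring (residue_ring (int n))) f}
      = n ^ 2 * (\<Prod>r = 1..l. p r ^ (2 * (e r - 1)) *
          card (Units (T_quaternion_ring (residue_ring (int (p r))))))"
    by (simp add: card_linear_permutation_polynomials)

  fix q :: nat
  assume q: "Factorial_Ring.prime q"
  then have q': "Factorial_Ring.prime (int q)"
    by simp
  note card_eq = residues.card_Units_T_quaternion_ring[OF residues_prime[OF q]]
  {
    assume none: "\<nexists>x. x \<in> carrier (residue_ring (int q)) \<and>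
      x \<otimes>\<^bsub>residue_ring (int q)\<^esub> x = (int q - 3) mod int q"
    \<comment> \<open>Any integer root reduces modulo \<open>q\<close> to a root in the carrier, so
      none exists among all integers.\<close>
    have "\<not> [x\<^sup>2 = -3] (mod int q)" for x
    proof
      assume "[x\<^sup>2 = -3] (mod int q)"
      then have "[(x mod int q)\<^sup>2 = -3] (mod int q)"
        by (simp add: cong_def power_mod)
      moreover have "x mod int q \<in> {0..<int q}"
        using prime_gt_0_nat[OF q] by simp
      ultimately show False
        using none unfolding root_iff carrier by blast
    qed
    then show "card (Units (T_quaternion_ring (residue_ring (int q)))) = q ^ 2 - 1"
      using card_norm_units_nonsquare[OF q'] by (simp add: card_eq)
  }
  assume "\<exists>x y. x \<in> carrier (residue_ring (int q)) \<and> y \<in> carrier (residue_ring (int q)) \<and> x \<noteq> y \<and>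
      x \<otimes>\<^bsub>residue_ring (int q)\<^esub> x = (int q - 3) mod int q \<and>
      y \<otimes>\<^bsub>residue_ring (int q)\<^esub> y = (int q - 3) mod int q"
  then obtain x y where "x \<in> {0..<int q}" "y \<in> {0..<int q}" "x \<noteq> y"
    "[x\<^sup>2 = -3] (mod int q)" "[y\<^sup>2 = -3] (mod int q)"
    unfolding root_iff carrier by blast
  \<comment> \<open>Distinct representatives in \<open>{0..<int q}\<close> are incongruent modulo
    \<open>q\<close>.\<close>
  then show "card (Units (T_quaternion_ring (residue_ring (int q)))) = (q - 1) ^ 2"
    using card_norm_units_square[OF q', of x y] by (simp add: card_eq cong_def)
qed

end
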